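(* Let $T$ be an operator on a separable infinite-dimensional Banach space $X$. Let $d\ge1$ and let $\Lambda\subset(0,+\infty)^d$ be a self-similar fractal with Hausdorff dimension $s>0$ satisfying the Open Set Condition. Then the (continuous) family $(T_\lambda)_{\lambda\in\Lambda}:=(\lambda(1)T\times\cdots\times\lambda(d)T)_{\lambda\in\Lambda}$ on $X^d$ does not admit any common upper frequently hypercyclic vector.
   Context: An operator is a continuous linear self-map. Points of $\mathbb R^d$ are written $\lambda=(\lambda(1),\dots,\lambda(d))$, and $\lambda(1)T\times\cdots\times\lambda(d)T$ acts coordinatewise on $X^d$. For $A\subset\mathbb N_0$, $\overline d(A)=\limsup_{n\to\infty}\frac{\#(A\cap[0,n])}{n+1}$. A vector $u\in Y$ is upper frequently hypercyclic for an operator $S$ on $Y$ if $\overline d(\{k\in\mathbb N_0:S^ku\in U\})>0$ for every non-empty open $U\subset Y$; a common upper frequently hypercyclic vector for $(T_\lambda)_{\lambda\in\Lambda}$ is one that is upper frequently hypercyclic for every $T_\lambda$. Self-similar fractals: an iterated function system is a finite set $\mathcal S=\{S_1,\dots,S_N\}$ of similitudes $S_i:\mathbb R^d\to\mathbb R^d$ with contraction ratios $0<r_i<1$. Its invariant set is the unique non-empty compact $\Lambda\subset\mathbb R^d$ with $\Lambda=\bigcup_{i=1}^NS_i(\Lambda)$; such a $\Lambda$ is called a self-similar fractal. It satisfies the Open Set Condition (OSC) if there is a non-empty bounded open $U\subset\mathbb R^d$ such that $S_1(U),\dots,S_N(U)$ are pairwise disjoint and contained in $U$. *)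

theory Defs
  imports "HOL-Analysis.Analysis"
begin

section \<open>Upper frequent hypercyclicity\<close>

definition upper_density :: "nat set \<Rightarrow> ereal" where
  "upper_density A = limsup (\<lambda>n. ereal (real (card (A \<inter> {0..n})) / (real n + 1)))"

definition upper_freq_hypercyclic :: "('b::topological_space \<Rightarrow> 'b) \<Rightarrow> 'b \<Rightarrow> bool" where
  "upper_freq_hypercyclic S u \<longleftrightarrow>
     (\<forall>U. open U \<and> U \<noteq> {} \<longrightarrow> 0 < upper_density {k. (S ^^ k) u \<in> U})"

definition common_upper_freq_hypercyclic ::
    "'l set \<Rightarrow> ('l \<Rightarrow> 'b::topological_space \<Rightarrow> 'b) \<Rightarrow> 'b \<Rightarrow> bool" where
  "common_upper_freq_hypercyclic \<Lambda> T u \<longleftrightarrow> (\<forall>l\<in>\<Lambda>. upper_freq_hypercyclic (T l) u)"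

definition mult_product_op ::
    "('a::real_normed_vector \<Rightarrow> 'a) \<Rightarrow> real ^ 'd \<Rightarrow> 'a ^ 'd \<Rightarrow> 'a ^ 'd" where
  "mult_product_op T l x = (\<chi> i. (l $ i) *\<^sub>R T (x $ i))"

lemma bounded_linear_mult_product_op:
  fixes T :: "'a::real_normed_vector \<Rightarrow> 'a" and l :: "real ^ 'd"
  assumes "bounded_linear T"
  shows "bounded_linear (mult_product_op T l)"
proof (rule bounded_linear_intro)
  interpret T: bounded_linear T by fact
  fix x y :: "'a ^ 'd" and r :: real
  show "mult_product_op T l (x + y) = mult_product_op T l x + mult_product_op T l y"
    by (simp add: mult_product_op_def vec_eq_iff T.add scaleR_add_right)
  show "mult_product_op T l (r *\<^sub>R x) = r *\<^sub>R mult_product_op T l x"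
    by (simp add: mult_product_op_def vec_eq_iff T.scaleR mult.commute)
  have "norm (mult_product_op T l x) \<le> (\<Sum>i\<in>UNIV. norm (mult_product_op T l x $ i))"
    unfolding norm_vec_def by (rule L2_set_le_sum) simp
  also have "\<dots> \<le> (\<Sum>i\<in>UNIV. norm x * (\<bar>l $ i\<bar> * onorm T))"
  proof (rule sum_mono)
    fix i
    have "norm (T (x $ i)) \<le> onorm T * norm (x $ i)"
      by (rule onorm [OF assms])
    also have "\<dots> \<le> onorm T * norm x"
      by (rule mult_left_mono [OF Finite_Cartesian_Product.norm_nth_le onorm_pos_le [OF assms]])
    finally have "\<bar>l $ i\<bar> * norm (T (x $ i)) \<le> \<bar>l $ i\<bar> * (onorm T * norm x)"
      by (rule mult_left_mono) simp
    then show "norm (mult_product_op T l x $ i) \<le> norm x * (\<bar>l $ i\<bar> * onorm T)"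
      by (simp add: mult_product_op_def mult_ac)
  qed
  finally show "norm (mult_product_op T l x) \<le> norm x * (\<Sum>i\<in>UNIV. \<bar>l $ i\<bar> * onorm T)"
    by (simp add: sum_distrib_left)
qed

text \<open>Joint continuity in the parameter and the vector: the family is a continuous family.\<close>

lemma continuous_mult_product_op:
  fixes T :: "'a::real_normed_vector \<Rightarrow> 'a"
  assumes "bounded_linear T"
  shows "continuous_on UNIV (\<lambda>(l :: real ^ 'd, x). mult_product_op T l x)"
  unfolding mult_product_op_def case_prod_unfold
  by (intro continuous_on_vec_lambda continuous_intros bounded_linear.continuous_on [OF assms])

section \<open>Hausdorff measure and dimension\<close>

text \<open>
  The empty set contributes \<open>0\<close>, and a one-point set contributes \<open>1\<close> when \<open>s = 0\<close> (so that
  the \<open>0\<close>-dimensional measure is the counting measure), whereas \<open>0 powr 0 = 0\<close>. Covering sets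
  are required to be bounded because \<^const>\<open>diameter\<close> is unspecified on unbounded sets.
\<close>

definition diam_powr :: "real \<Rightarrow> 'b::metric_space set \<Rightarrow> ennreal" where
  "diam_powr s U =
     (if U = {} then 0 else if s = 0 then 1 else ennreal (diameter U powr s))"

definition hausdorff_pre_measure :: "real \<Rightarrow> real \<Rightarrow> 'b::metric_space set \<Rightarrow> ennreal" where
  "hausdorff_pre_measure s \<delta> A =
     (INF U\<in>{U :: nat \<Rightarrow> 'b set.
               A \<subseteq> (\<Union>i. U i) \<and> (\<forall>i. bounded (U i) \<and> diameter (U i) \<le> \<delta>)}.
        \<Sum>i. diam_powr s (U i))"

definition hausdorff_measure :: "real \<Rightarrow> 'b::metric_space set \<Rightarrow> ennreal" where
  "hausdorff_measure s A = (SUP \<delta>\<in>{0<..}. hausdorff_pre_measure s \<delta> A)"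

definition hausdorff_dim :: "'b::metric_space set \<Rightarrow> ennreal" where
  "hausdorff_dim A = (INF s\<in>{s. 0 \<le> s \<and> hausdorff_measure s A = 0}. ennreal s)"

section \<open>Self-similar fractals\<close>

definition similitude :: "real \<Rightarrow> ('b::metric_space \<Rightarrow> 'b) \<Rightarrow> bool" where
  "similitude r S \<longleftrightarrow> (\<forall>x y. dist (S x) (S y) = r * dist x y)"

definition iterated_function_system :: "('b::metric_space \<Rightarrow> 'b) set \<Rightarrow> bool" where
  "iterated_function_system \<S> \<longleftrightarrow>
     finite \<S> \<and> (\<forall>S\<in>\<S>. \<exists>r. 0 < r \<and> r < 1 \<and> similitude r S)"

text \<open>
  For an iterated function system on a complete space there is at most one such set
  (and exactly one if the system is non-empty).
\<close>

definition invariant_set :: "('b::metric_space \<Rightarrow> 'b) set \<Rightarrow> 'b set \<Rightarrow> bool" where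
  "invariant_set \<S> \<Lambda> \<longleftrightarrow> \<Lambda> \<noteq> {} \<and> compact \<Lambda> \<and> \<Lambda> = (\<Union>S\<in>\<S>. S ` \<Lambda>)"

definition open_set_condition :: "('b::metric_space \<Rightarrow> 'b) set \<Rightarrow> bool" where
  "open_set_condition \<S> \<longleftrightarrow>
     (\<exists>U. U \<noteq> {} \<and> bounded U \<and> open U \<and>
        (\<forall>S\<in>\<S>. S ` U \<subseteq> U) \<and> disjoint_family_on (\<lambda>S. S ` U) \<S>)"

definition self_similar_fractal_OSC :: "'b::metric_space set \<Rightarrow> bool" where
  "self_similar_fractal_OSC \<Lambda> \<longleftrightarrow>
     (\<exists>\<S>. iterated_function_system \<S> \<and> invariant_set \<S> \<Lambda> \<and> open_set_condition \<S>)"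

end

theory Submission
  imports Defs "HOL-Probability.Infinite_Product_Measure" "HOL-Probability.Probability_Mass_Function"
begin

text \<open>
  Fix \<open>u\<close> and look at the open set \<open>U\<close> of all vectors whose coordinates have norm strictly between
  \<open>1\<close> and \<open>2\<close>. Since the \<open>i\<close>-th coordinate of \<open>T\<^sub>\<lambda>\<^sup>k u\<close> is \<open>\<lambda>(i)\<^sup>k T\<^sup>k u(i)\<close>, two parameters that
  both send \<open>u\<close> into \<open>U\<close> at time \<open>k\<close> have coordinates whose \<open>k\<close>-th powers differ by a factor less
  than \<open>2\<close>. The set \<open>V\<^sub>k\<close> of these parameters therefore has diameter \<open>O(1/k)\<close>
  (\<open>return_set_diameter\<close>). On a set of positive dimension such small sets cannot be visited with
  positive density by every point: an averaging argument finds a \<open>\<lambda> \<in> \<Lambda>\<close> for which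
  \<open>{k. \<lambda> \<in> V\<^sub>k}\<close> has upper density \<open>0\<close>, so that \<open>u\<close> is not upper frequently hypercyclic
  for \<open>T\<^sub>\<lambda>\<close>.

  The averaging takes place on a Cantor set rather than with respect to Hausdorff measure. As
  \<open>\<Lambda>\<close> has positive dimension, it contains two distinct points; around them lie two small copies
  \<open>F\<^sub>0(\<Lambda>)\<close> and \<open>F\<^sub>1(\<Lambda>)\<close> at positive distance (\<open>self_similar_two_separated_copies\<close>). Iterating
  \<open>F\<^sub>0\<close> and \<open>F\<^sub>1\<close> along a sequence of coin tosses leads to a random point of \<open>\<Lambda>\<close>. The
  \<open>2\<^sup>m\<close> cylinders of generation \<open>m\<close> are separated by a distance of order \<open>\<rho>\<^sup>m\<close>
  (\<open>cylinders_separated\<close>), so \<open>V\<^sub>k\<close> meets at most one cylinder of generation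
  \<open>m \<approx> log k / log (1/\<rho>)\<close>, and the random point lies in \<open>V\<^sub>k\<close> with probability \<open>O(k\<^sup>-\<^sup>t)\<close> for
  some \<open>t > 0\<close>. Hence the expectation of \<open>\<Sum> 1/k\<close> over all \<open>k\<close> with \<open>\<lambda> \<in> V\<^sub>k\<close> is at most a
  constant times \<open>\<Sum>\<^sub>k k\<^sup>-\<^sup>1\<^sup>-\<^sup>t < \<infinity>\<close>. For some \<open>\<lambda>\<close> the harmonic sum over its visits is thus
  finite, which forces density \<open>0\<close> (\<open>upper_density_eq_0_if_harmonic_summable\<close>).
\<close>

section \<open>Density\<close>

text \<open>
  Beyond an index \<open>K\<close> where the tail of the harmonic sum is below \<open>e / 2\<close>, each element of \<open>A\<close>
  between \<open>K\<close> and \<open>n\<close> contributes at least \<open>1 / (n + 1)\<close> to that tail, so there are at most \<open>(n + 1) e / 2\<close> of them;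
  the other \<open>K\<close> indices are negligible.
\<close>

lemma upper_density_eq_0_if_harmonic_summable:
  fixes A :: "nat set"
  assumes "summable (\<lambda>k. indicator A k / (real k + 1))"
  shows "upper_density A = 0"
proof -
  let ?h = "\<lambda>k. indicator A k / (real k + 1) :: real"
  let ?d = "\<lambda>n. real (card (A \<inter> {0..n})) / (real n + 1)"
  have "?d \<longlonglongrightarrow> 0"
  proof (rule LIMSEQ_I)
    fix e :: real assume "0 < e"
    then have "0 < e / 2" by simp
    from suminf_exist_split [OF this assms]
    obtain K where "norm (\<Sum>i. ?h (i + K)) < e / 2" by blast
    then have tail: "(\<Sum>i. ?h (i + K)) < e / 2" by simp
    have bound: "?d n < e" if n: "n \<ge> K" "real n \<ge> 2 * real K / e" for n
    proof -
      have "real (card (A \<inter> {0..n})) = (\<Sum>k\<le>n. indicator A k)"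
        by (simp add: indicator_def atMost_atLeast0 Int_commute flip: sum.inter_filter Collect_conj_eq)
      also have "\<dots> = (\<Sum>k<K. indicator A k) + (\<Sum>k=K..n. indicator A k)"
      proof -
        have "{..n} = {..<K} \<union> {K..n}" using n by auto
        then show ?thesis by (simp add: sum.union_disjoint ivl_disj_int)
      qed
      also have "(\<Sum>k<K. indicator A k) \<le> (\<Sum>k<K. 1::real)"
        by (intro sum_mono) (simp add: indicator_def)
      also have "(\<Sum>k=K..n. indicator A k) \<le> (\<Sum>k=K..n. (real n + 1) * ?h k)"
        by (intro sum_mono) (auto simp: indicator_def field_simps)
      also have "\<dots> = (real n + 1) * (\<Sum>i<Suc n - K. ?h (i + K))"
        unfolding sum_distrib_left
        by (rule sum.reindex_bij_witness [where i = "\<lambda>i. i + K" and j = "\<lambda>k. k - K"]) auto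
      also have "(\<Sum>i<Suc n - K. ?h (i + K)) \<le> (\<Sum>i. ?h (i + K))"
        by (intro sum_le_suminf summable_ignore_initial_segment[OF assms]) auto
      also have "\<dots> \<le> e / 2" using tail by simp
      finally have "real (card (A \<inter> {0..n})) \<le> real K + (real n + 1) * (e / 2)"
        by simp
      moreover have "real K \<le> real n * (e / 2)" using n \<open>0 < e\<close> by (simp add: field_simps)
      ultimately have "real (card (A \<inter> {0..n})) < e * (real n + 1)"
        using \<open>0 < e\<close> by (simp add: field_simps)
      then show ?thesis by (simp add: field_simps)
    qed
    show "\<exists>N. \<forall>n\<ge>N. norm (?d n - 0) < e"
    proof (intro exI allI impI)
      fix n assume N: "n \<ge> max K (nat \<lceil>2 * real K / e\<rceil>)"
      then have "real n \<ge> 2 * real K / e" by linarith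
      then show "norm (?d n - 0) < e" using bound N by simp
    qed
  qed
  then have "(\<lambda>n. ereal (?d n)) \<longlonglongrightarrow> ereal 0" by (rule tendsto_ereal)
  then show ?thesis
    unfolding upper_density_def zero_ereal_def by (rule lim_imp_Limsup [OF sequentially_bot])
qed

section \<open>Coin tossing\<close>

definition coin_space :: "(nat \<Rightarrow> bool) measure" where
  "coin_space = (\<Pi>\<^sub>M i\<in>UNIV. measure_pmf (pmf_of_set UNIV))"

lemma emeasure_coin_space_prefix:
  fixes w :: "bool list"
  shows "{\<omega>. map \<omega> [0..<length w] = w} \<in> sets coin_space"
    and "emeasure coin_space {\<omega>. map \<omega> [0..<length w] = w} = ennreal ((1 / 2) ^ length w)"
proof -
  interpret product_prob_space "\<lambda>_. measure_pmf (pmf_of_set UNIV :: bool pmf)" UNIV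
    by unfold_locales
  have eq: "{\<omega>. map \<omega> [0..<length w] = w} =
      {\<omega>\<in>space coin_space. \<forall>i\<in>{..<length w}. \<omega> i \<in> {w ! i}}"
  proof -
    have "map \<omega> [0..<length w] = w \<longleftrightarrow> (\<forall>i<length w. \<omega> i = w ! i)" for \<omega>
      by (subst list_eq_iff_nth_eq) simp
    then show ?thesis by (simp add: coin_space_def space_PiM Ball_def)
  qed
  show "{\<omega>. map \<omega> [0..<length w] = w} \<in> sets coin_space"
    unfolding eq coin_space_def
    by (intro sets.sets_Collect_finite_All sets_Collect_single') auto
  have one: "emeasure (measure_pmf (pmf_of_set (UNIV :: bool set))) {b} = ennreal (1 / 2)" for b
    by (simp add: emeasure_pmf_single)
  have "emeasure coin_space {\<omega>. map \<omega> [0..<length w] = w} =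
      (\<Prod>i\<in>{..<length w}. emeasure (measure_pmf (pmf_of_set UNIV)) {w ! i})"
    unfolding eq coin_space_def by (rule emeasure_PiM_Collect) auto
  also have "\<dots> = ennreal (1 / 2) ^ length w"
    unfolding one prod_constant card_lessThan ..
  also have "\<dots> = ennreal ((1 / 2) ^ length w)" by (rule ennreal_power) simp
  finally show "emeasure coin_space {\<omega>. map \<omega> [0..<length w] = w} = \<dots>" .
qed

text \<open>
  Under coin tossing, the sum of \<open>a k\<close> over the words \<open>w k\<close> that are prefixes of the outcome has
  expectation \<open>\<Sum>\<^sub>k a k 2\<^sup>-\<^sup>|\<^sup>w\<^sup>(\<^sup>k\<^sup>)\<^sup>|\<close>. It is finite, so the sum is finite almost surely.
\<close>

lemma ex_sequence_summable_prefixes: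
  fixes w :: "nat \<Rightarrow> bool list" and a :: "nat \<Rightarrow> real"
  assumes a: "\<And>k. 0 \<le> a k" and sm: "summable (\<lambda>k. a k * (1 / 2) ^ length (w k))"
  shows "\<exists>\<omega>. summable (\<lambda>k. indicator {k. map \<omega> [0..<length (w k)] = w k} k * a k)"
proof -
  interpret prob_space coin_space
    unfolding coin_space_def by (intro prob_space_PiM measure_pmf.prob_space_axioms)
  define C where "C k = {\<omega>. map \<omega> [0..<length (w k)] = w k}" for k
  have C [measurable]: "C k \<in> sets coin_space" for k
    unfolding C_def by (rule emeasure_coin_space_prefix)
  let ?F = "\<lambda>\<omega>. \<Sum>k. ennreal (a k) * indicator (C k) \<omega>"
  have "(\<integral>\<^sup>+ \<omega>. ?F \<omega> \<partial>coin_space) = (\<Sum>k. ennreal (a k) * emeasure coin_space (C k))"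
    by (subst nn_integral_suminf) (auto simp: nn_integral_cmult)
  also have "\<dots> = (\<Sum>k. ennreal (a k * (1 / 2) ^ length (w k)))"
    unfolding C_def emeasure_coin_space_prefix(2) using a by (simp add: ennreal_mult)
  also have "\<dots> \<noteq> \<infinity>"
    using a sm by (subst suminf_ennreal2) auto
  finally have "AE \<omega> in coin_space. ?F \<omega> \<noteq> \<infinity>"
    by (intro nn_integral_PInf_AE) auto
  from eventually_happens'[OF ae_filter_bot this] obtain \<omega> where \<omega>: "?F \<omega> \<noteq> \<infinity>" ..
  have "?F \<omega> = (\<Sum>k. ennreal (indicator (C k) \<omega> * a k))"
    by (intro suminf_cong) (auto simp: indicator_def)
  with \<omega> have "summable (\<lambda>k. indicator (C k) \<omega> * a k)"
    using a by (intro summable_suminf_not_top) auto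
  moreover have "indicator (C k) \<omega> = (indicator {k. map \<omega> [0..<length (w k)] = w k} k :: real)" for k
    by (auto simp: C_def split: split_indicator)
  ultimately show ?thesis by auto
qed

section \<open>Cantor sets generated by two maps\<close>

primrec cylinder :: "(bool \<Rightarrow> 'b \<Rightarrow> 'b) \<Rightarrow> 'b set \<Rightarrow> bool list \<Rightarrow> 'b set" where
  "cylinder F \<Lambda> [] = \<Lambda>"
| "cylinder F \<Lambda> (b # w) = F b ` cylinder F \<Lambda> w"

lemma cylinder_append_subset:
  assumes "\<And>b. F b ` \<Lambda> \<subseteq> \<Lambda>"
  shows "cylinder F \<Lambda> (v @ w) \<subseteq> cylinder F \<Lambda> v"
proof (induction v)
  case Nil
  have "cylinder F \<Lambda> w \<subseteq> \<Lambda>"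
    using assms by (induction w) auto
  then show ?case by simp
next
  case (Cons b v)
  then show ?case by auto
qed

text \<open>
  The maps along the common prefix of \<open>v\<close> and \<open>w\<close> shrink distances at most by \<open>\<rho>\<close> each;
  at the first letter where the words differ, the two images of \<open>\<Lambda>\<close> are \<open>\<delta>\<close> apart.
\<close>

lemma cylinders_separated:
  fixes F :: "bool \<Rightarrow> 'b::metric_space \<Rightarrow> 'b"
  assumes inv: "\<And>b. F b ` \<Lambda> \<subseteq> \<Lambda>"
    and expand: "\<And>b x y. \<rho> * dist x y \<le> dist (F b x) (F b y)"
    and sep: "\<And>x y. x \<in> \<Lambda> \<Longrightarrow> y \<in> \<Lambda> \<Longrightarrow> \<delta> \<le> dist (F True x) (F False y)"
    and "0 < \<rho>" "\<rho> \<le> 1" "0 < \<delta>"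
    and "length v = length w" "v \<noteq> w" "x \<in> cylinder F \<Lambda> v" "y \<in> cylinder F \<Lambda> w"
  shows "\<rho> ^ length w * \<delta> \<le> dist x y"
  using assms(7-)
proof (induction v w arbitrary: x y rule: list_induct2)
  case (Cons b v c w)
  obtain x' y' where x': "x = F b x'" "x' \<in> cylinder F \<Lambda> v"
    and y': "y = F c y'" "y' \<in> cylinder F \<Lambda> w"
    using Cons.prems by auto
  show ?case
  proof (cases "b = c")
    case True
    with Cons x' y' have "\<rho> ^ length w * \<delta> \<le> dist x' y'" by auto
    then have "\<rho> * (\<rho> ^ length w * \<delta>) \<le> \<rho> * dist x' y'" using \<open>0 < \<rho>\<close> by simp
    also have "\<dots> \<le> dist x y" using expand x' y' True by simp
    finally show ?thesis by simp
  next
    case False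
    have mem: "x' \<in> \<Lambda>" "y' \<in> \<Lambda>"
      using cylinder_append_subset[of F \<Lambda> "[]"] inv x' y' by auto
    have "\<rho> ^ length (c # w) * \<delta> \<le> 1 * \<delta>"
      using \<open>0 < \<rho>\<close> \<open>\<rho> \<le> 1\<close> \<open>0 < \<delta>\<close> by (intro mult_right_mono power_le_one) auto
    also have "\<dots> \<le> dist x y"
      using sep[of x' y'] sep[of y' x'] mem False x' y'
      by (cases b; cases c) (auto simp: dist_commute)
    finally show ?thesis .
  qed
qed simp

lemma cylinders_along_sequence_meet:
  fixes F :: "bool \<Rightarrow> 'b::heine_borel \<Rightarrow> 'b"
  assumes inv: "\<And>b. F b ` \<Lambda> \<subseteq> \<Lambda>" and cont: "\<And>b. continuous_on UNIV (F b)"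
    and "compact \<Lambda>" "\<Lambda> \<noteq> {}"
  shows "\<exists>x\<in>\<Lambda>. \<forall>m. x \<in> cylinder F \<Lambda> (map \<omega> [0..<m])"
proof -
  have cpt: "compact (cylinder F \<Lambda> w) \<and> cylinder F \<Lambda> w \<noteq> {}" for w
  proof (induction w)
    case (Cons b w)
    then show ?case
      using compact_continuous_image[OF continuous_on_subset[OF cont subset_UNIV]] by auto
  qed (use assms in auto)
  have nest: "cylinder F \<Lambda> (map \<omega> [0..<n]) \<subseteq> cylinder F \<Lambda> (map \<omega> [0..<m])" if "m \<le> n" for m n
  proof -
    have "[0..<n] = [0..<m] @ [m..<n]"
      using upt_add_eq_append[of 0 m "n - m"] that by simp
    then show ?thesis
      using cylinder_append_subset[of F \<Lambda> "map \<omega> [0..<m]" "map \<omega> [m..<n]"] inv by simp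
  qed
  have "\<Inter>(range (\<lambda>m. cylinder F \<Lambda> (map \<omega> [0..<m]))) \<noteq> {}"
    by (rule compact_nest) (use cpt nest in auto)
  then obtain x where "\<forall>m. x \<in> cylinder F \<Lambda> (map \<omega> [0..<m])" by auto
  then show ?thesis by (intro bexI[of _ x]) (auto dest: spec[of _ 0])
qed

text \<open>
  Cylinders of generation \<open>m\<close> are separated at the scale \<open>\<rho>\<^sup>m\<close>, and \<open>m\<close> is taken maximal such that
  this scale still exceeds \<open>\<epsilon>\<close>. By maximality \<open>\<rho>\<^sup>m\<^sup>+\<^sup>1 \<le> \<epsilon>\<close>, and \<open>t\<close> is the exponent converting the scale
  \<open>\<rho>\<^sup>m\<close> into the probability \<open>2\<^sup>-\<^sup>m\<close>; passing from \<open>m + 1\<close> to \<open>m\<close> costs the factor \<open>2\<close>.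
  The alternative \<open>m = 0\<close> covers \<open>\<epsilon> \<ge> 1\<close>, where no generation resolves the scale \<open>\<epsilon>\<close>.
\<close>

lemma ex_cylinder_length:
  fixes \<rho> \<epsilon> t :: real
  assumes "0 < \<rho>" "\<rho> < 1" "0 < \<epsilon>" and t: "0 < t" "\<rho> powr t = 1 / 2"
  shows "\<exists>m::nat. (m = 0 \<or> \<epsilon> < \<rho> ^ m) \<and> (1 / 2) ^ m \<le> 2 * \<epsilon> powr t"
proof -
  have half: "(\<rho> ^ m) powr t = (1 / 2) ^ m" for m
  proof -
    have "(\<rho> ^ m) powr t = (\<rho> powr t) powr real m"
      using \<open>0 < \<rho>\<close> by (simp add: powr_powr mult.commute flip: powr_realpow)
    also have "\<dots> = (1 / 2) ^ m"
      unfolding t by (rule powr_realpow) simp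
    finally show ?thesis .
  qed
  have "\<exists>m. \<rho> ^ m \<le> \<epsilon>"
    using real_arch_pow_inv[OF \<open>0 < \<epsilon>\<close> \<open>\<rho> < 1\<close>] by (auto intro: less_imp_le)
  then obtain n where n: "\<rho> ^ n \<le> \<epsilon>" "\<And>m. m < n \<Longrightarrow> \<not> \<rho> ^ m \<le> \<epsilon>"
    using exists_least_iff[of "\<lambda>m. \<rho> ^ m \<le> \<epsilon>"] by auto
  have le: "(1 / 2) ^ n \<le> \<epsilon> powr t"
    unfolding half[symmetric] using n assms by (intro powr_mono2) auto
  show ?thesis
  proof (cases n)
    case 0
    then show ?thesis using le by (intro exI[of _ 0]) auto
  next
    case (Suc m)
    then show ?thesis using n(2)[of m] le by (intro exI[of _ m]) auto
  qed
qed

text \<open>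
  The heart of the argument: sets whose diameters decay like \<open>1/k\<close> are too small to be
  visited with positive density by all points of a Cantor set. Each \<open>V k\<close> is captured by a single
  cylinder, whose coin tossing probability is \<open>O((k + 1)\<^sup>-\<^sup>t)\<close>.
\<close>

lemma ex_point_visits_have_density_0:
  fixes F :: "bool \<Rightarrow> 'b::heine_borel \<Rightarrow> 'b" and V :: "nat \<Rightarrow> 'b set"
  assumes inv: "\<And>b. F b ` \<Lambda> \<subseteq> \<Lambda>" and cont: "\<And>b. continuous_on UNIV (F b)"
    and expand: "\<And>b x y. \<rho> * dist x y \<le> dist (F b x) (F b y)"
    and sep: "\<And>x y. x \<in> \<Lambda> \<Longrightarrow> y \<in> \<Lambda> \<Longrightarrow> \<delta> \<le> dist (F True x) (F False y)"
    and \<rho>: "0 < \<rho>" "\<rho> < 1" and \<delta>: "0 < \<delta>"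
    and "compact \<Lambda>" "\<Lambda> \<noteq> {}"
    and C: "0 < C"
    and V: "\<And>k x y. x \<in> V k \<Longrightarrow> y \<in> V k \<Longrightarrow> dist x y \<le> C / (real k + 1)"
  shows "\<exists>x\<in>\<Lambda>. upper_density {k. x \<in> V k} = 0"
proof -
  define t where "t = ln 2 / ln (1 / \<rho>)"
  have tpos: "0 < t" unfolding t_def using \<rho> by (intro divide_pos_pos) auto
  have half: "\<rho> powr t = 1 / 2"
    using \<rho> by (simp add: powr_def t_def ln_div exp_minus inverse_eq_divide)
  define \<epsilon> where "\<epsilon> k = C / \<delta> / (real k + 1)" for k
  have \<epsilon>: "0 < \<epsilon> k" for k using C \<delta> by (simp add: \<epsilon>_def)
  have "\<exists>m. \<forall>k. (m k = 0 \<or> \<epsilon> k < \<rho> ^ m k) \<and> (1 / 2) ^ m k \<le> 2 * \<epsilon> k powr t"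
    using ex_cylinder_length[OF \<rho> \<epsilon> tpos half] by (intro choice) auto
  then obtain m :: "nat \<Rightarrow> nat" where m: "\<And>k. m k = 0 \<or> \<epsilon> k < \<rho> ^ m k"
    "\<And>k. (1 / 2) ^ m k \<le> 2 * \<epsilon> k powr t" by blast
  \<comment> \<open>At most one word of length \<open>m k\<close> has a cylinder meeting \<open>V k\<close>; if there is none, any word will do.\<close>
  have "\<exists>w. length w = m k \<and>
      (\<forall>v. length v = m k \<longrightarrow> cylinder F \<Lambda> v \<inter> V k \<noteq> {} \<longrightarrow> v = w)" for k
  proof (cases "\<exists>w. length w = m k \<and> cylinder F \<Lambda> w \<inter> V k \<noteq> {}")
    case True
    then obtain w x where w: "length w = m k" and x: "x \<in> cylinder F \<Lambda> w" "x \<in> V k" by auto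
    have "v = w" if v: "length v = m k" "y \<in> cylinder F \<Lambda> v" "y \<in> V k" for v y
    proof (rule ccontr)
      assume "v \<noteq> w"
      then have "m k \<noteq> 0"
        using v(1) w by (cases "m k = 0") simp_all
      with m(1)[of k] have "\<epsilon> k * \<delta> < \<rho> ^ m k * \<delta>" using \<delta> by simp
      also have "\<dots> \<le> dist y x"
        using cylinders_separated[of F \<Lambda> \<rho> \<delta> v w y x] inv expand sep \<rho> \<delta> v w x \<open>v \<noteq> w\<close> by auto
      also have "\<dots> \<le> C / (real k + 1)" using V v x by blast
      finally show False using \<delta> by (simp add: \<epsilon>_def)
    qed
    then show ?thesis using w by blast
  next
    case False
    then show ?thesis by (intro exI[of _ "replicate (m k) True"]) auto
  qed
  then obtain w where w: "\<And>k. length (w k) = m k"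
    "\<And>k v. length v = m k \<Longrightarrow> cylinder F \<Lambda> v \<inter> V k \<noteq> {} \<Longrightarrow> v = w k" by metis
  have "summable (\<lambda>k. 1 / (real k + 1) * (1 / 2) ^ length (w k))"
  proof (rule summable_comparison_test)
    have "summable (\<lambda>k. real k powr (- 1 - t))"
      using tpos by (simp add: summable_real_powr_iff)
    then have "summable (\<lambda>k. (real (Suc k)) powr (- 1 - t))"
      by (rule summable_Suc_iff[THEN iffD2])
    then show "summable (\<lambda>k. 2 * (C / \<delta>) powr t * (real (Suc k)) powr (- 1 - t))"
      by (rule summable_mult)
    have "1 / (real k + 1) * (1 / 2) ^ length (w k) \<le> 2 * (C / \<delta>) powr t * (real (Suc k)) powr (- 1 - t)"
      for k
    proof -
      have "1 / (real k + 1) * (1 / 2) ^ length (w k) \<le> 1 / (real k + 1) * (2 * \<epsilon> k powr t)"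
        unfolding w by (intro mult_left_mono m) auto
      also have "\<epsilon> k powr t = (C / \<delta>) powr t / real (Suc k) powr t"
        using C \<delta> unfolding \<epsilon>_def by (subst powr_divide) (auto simp: add.commute)
      also have "1 / (real k + 1) * (2 * \<dots>) = 2 * (C / \<delta>) powr t * (real (Suc k)) powr (- 1 - t)"
        by (simp add: powr_diff powr_minus_divide add.commute)
      finally show ?thesis .
    qed
    then show "\<exists>N. \<forall>k\<ge>N. norm (1 / (real k + 1) * (1 / 2) ^ length (w k))
        \<le> 2 * (C / \<delta>) powr t * (real (Suc k)) powr (- 1 - t)"
      by auto
  qed
  then obtain \<omega> where
    \<omega>: "summable (\<lambda>k. indicator {k. map \<omega> [0..<length (w k)] = w k} k * (1 / (real k + 1)) :: real)"
    using ex_sequence_summable_prefixes[of "\<lambda>k. 1 / (real k + 1)" w] by auto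
  obtain x where x: "x \<in> \<Lambda>" "\<And>n. x \<in> cylinder F \<Lambda> (map \<omega> [0..<n])"
    using cylinders_along_sequence_meet[of F \<Lambda> \<omega>] assms by blast
  have sub: "map \<omega> [0..<length (w k)] = w k" if "x \<in> V k" for k
    using x(2)[of "m k"] that w by (intro w(2)) auto
  have "summable (\<lambda>k. indicator {k. x \<in> V k} k / (real k + 1) :: real)"
    by (rule summable_comparison_test[OF _ \<omega>]) (use sub in \<open>auto simp: indicator_def\<close>)
  then have "upper_density {k. x \<in> V k} = 0"
    by (rule upper_density_eq_0_if_harmonic_summable)
  with x show ?thesis by blast
qed

section \<open>Self-similar sets\<close>

lemma invariant_set_small_copies:
  fixes \<S> :: "('b::metric_space \<Rightarrow> 'b) set"
  assumes inv: "\<Lambda> = (\<Union>S\<in>\<S>. S ` \<Lambda>)"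
    and sim: "\<And>S. S \<in> \<S> \<Longrightarrow> \<exists>r. 0 < r \<and> r \<le> R \<and> similitude r S" and "0 \<le> R"
    and "x \<in> \<Lambda>"
  shows "\<exists>F r. 0 < r \<and> r \<le> R ^ n \<and> similitude r F \<and> F ` \<Lambda> \<subseteq> \<Lambda> \<and> x \<in> F ` \<Lambda>"
  using \<open>x \<in> \<Lambda>\<close>
proof (induction n arbitrary: x)
  case 0
  then show ?case by (intro exI[of _ id] exI[of _ 1]) (auto simp: similitude_def)
next
  case (Suc n)
  from Suc.prems inv obtain S y where S: "S \<in> \<S>" "y \<in> \<Lambda>" "x = S y" by blast
  from sim[OF S(1)] obtain q where q: "0 < q" "q \<le> R" "similitude q S" by blast
  from Suc.IH[OF S(2)] obtain F r where
    F: "0 < r" "r \<le> R ^ n" "similitude r F" "F ` \<Lambda> \<subseteq> \<Lambda>" "y \<in> F ` \<Lambda>" by blast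
  have "S ` \<Lambda> \<subseteq> \<Lambda>" using inv S(1) by blast
  with q F S \<open>0 \<le> R\<close> show ?case
    by (intro exI[of _ "S \<circ> F"] exI[of _ "q * r"])
      (auto simp: similitude_def image_subset_iff intro!: mult_mono)
qed

text \<open>
  Copies of \<open>\<Lambda>\<close> through \<open>p\<close> and through \<open>q\<close> of diameter at most a third of \<open>dist p q\<close> stay at least
  that third apart. Their similarity ratios, being positive, give the lower bound \<open>\<rho>\<close>.
\<close>

lemma self_similar_two_separated_copies:
  fixes \<S> :: "('b::metric_space \<Rightarrow> 'b) set"
  assumes ifs: "iterated_function_system \<S>" and inv: "invariant_set \<S> \<Lambda>"
    and pq: "p \<in> \<Lambda>" "q \<in> \<Lambda>" "p \<noteq> q"
  obtains F :: "bool \<Rightarrow> 'b \<Rightarrow> 'b" and \<rho> \<delta> where "\<And>b. F b ` \<Lambda> \<subseteq> \<Lambda>" "\<And>b. continuous_on UNIV (F b)"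
    "\<And>b x y. \<rho> * dist x y \<le> dist (F b x) (F b y)"
    "\<And>x y. x \<in> \<Lambda> \<Longrightarrow> y \<in> \<Lambda> \<Longrightarrow> \<delta> \<le> dist (F True x) (F False y)"
    "0 < \<rho>" "\<rho> < 1" "0 < \<delta>"
proof -
  have cpt: "compact \<Lambda>" and inv': "\<Lambda> = (\<Union>S\<in>\<S>. S ` \<Lambda>)"
    using inv by (auto simp: invariant_set_def)
  have fin: "finite \<S>" and "\<forall>S\<in>\<S>. \<exists>r. 0 < r \<and> r < 1 \<and> similitude r S"
    using ifs by (auto simp: iterated_function_system_def)
  then obtain r where r: "\<And>S. S \<in> \<S> \<Longrightarrow> 0 < r S \<and> r S < 1 \<and> similitude (r S) S" by metis
  define R where "R = Max (insert 0 (r ` \<S>))"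
  have R: "0 \<le> R" "R < 1" "\<And>S. S \<in> \<S> \<Longrightarrow> r S \<le> R"
    unfolding R_def using fin r by auto
  define D where "D = diameter \<Lambda> + 1"
  have D: "0 < D" "\<And>x y. x \<in> \<Lambda> \<Longrightarrow> y \<in> \<Lambda> \<Longrightarrow> dist x y \<le> D"
    using diameter_bounded_bound[OF compact_imp_bounded[OF cpt]]
      diameter_ge_0[OF compact_imp_bounded[OF cpt]] unfolding D_def
    by (auto intro: order_trans[OF _ less_imp_le] simp: add_nonneg_pos) fastforce
  define \<delta> where "\<delta> = dist p q / 3"
  have \<delta>: "0 < \<delta>" using pq by (simp add: \<delta>_def)
  obtain n where n: "R ^ n < \<delta> / D"
    using real_arch_pow_inv[of "\<delta> / D" R] R \<delta> D by auto
  have ex: "\<exists>F r. 0 < r \<and> r \<le> R ^ n \<and> similitude r F \<and> F ` \<Lambda> \<subseteq> \<Lambda> \<and> x \<in> F ` \<Lambda>" if "x \<in> \<Lambda>" for x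
    by (rule invariant_set_small_copies[OF inv']) (use r R that in auto)
  obtain f a p' where f: "0 < a" "a \<le> R ^ n" "similitude a f" "f ` \<Lambda> \<subseteq> \<Lambda>" "p' \<in> \<Lambda>" "p = f p'"
    using ex[OF pq(1)] by blast
  obtain g b q' where g: "0 < b" "b \<le> R ^ n" "similitude b g" "g ` \<Lambda> \<subseteq> \<Lambda>" "q' \<in> \<Lambda>" "q = g q'"
    using ex[OF pq(2)] by blast
  have small: "c * dist x y \<le> \<delta>" if "0 < c" "c \<le> R ^ n" "x \<in> \<Lambda>" "y \<in> \<Lambda>" for c x y
  proof -
    have "c * dist x y \<le> \<delta> / D * D"
      using that n D \<delta> by (intro mult_mono) auto
    then show ?thesis using D by simp
  qed
  have sep: "\<delta> \<le> dist (f x) (g y)" if "x \<in> \<Lambda>" "y \<in> \<Lambda>" for x y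
  proof -
    have "dist p (f x) \<le> \<delta>" "dist q (g y) \<le> \<delta>"
      using small[OF f(1,2) f(5) that(1)] small[OF g(1,2) g(5) that(2)] f g
      by (auto simp: similitude_def)
    moreover have "dist p q \<le> dist p (f x) + dist (f x) (g y) + dist q (g y)"
      by (metis add_mono_thms_linordered_semiring(3) dist_commute dist_triangle order_trans)
    ultimately show ?thesis by (simp add: \<delta>_def)
  qed
  \<comment> \<open>The extra \<open>1 / 2\<close> guarantees \<open>\<rho> < 1\<close> also when \<open>R ^ n = 1\<close>.\<close>
  define \<rho> where "\<rho> = min (1 / 2) (min a b)"
  define F where "F c = (if c then f else g)" for c
  have cont: "continuous_on UNIV h" if "similitude c h" "0 < c" for c :: real and h :: "'b \<Rightarrow> 'b"
  proof -
    have "c-lipschitz_on UNIV h"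
      using that by (intro lipschitz_onI) (auto simp: similitude_def)
    then show ?thesis by (rule lipschitz_on_continuous_on)
  qed
  show ?thesis
  proof (rule that[of F \<rho> \<delta>])
    show "F c ` \<Lambda> \<subseteq> \<Lambda>" "continuous_on UNIV (F c)" for c
      using f g cont by (auto simp: F_def)
    show "\<rho> * dist x y \<le> dist (F c x) (F c y)" for c x y
    proof -
      have "\<rho> * dist x y \<le> (if c then a else b) * dist x y"
        by (intro mult_right_mono) (auto simp: \<rho>_def)
      also have "\<dots> = dist (F c x) (F c y)" using f g by (auto simp: F_def similitude_def)
      finally show ?thesis .
    qed
  qed (use sep f g \<delta> in \<open>auto simp: F_def \<rho>_def\<close>)
qed

lemma hausdorff_dim_singleton: "hausdorff_dim {p :: 'b::metric_space} = 0"
proof -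
  have meas: "hausdorff_measure s {p} = 0" if "0 < s" for s
  proof -
    have "hausdorff_pre_measure s \<delta> {p} \<le> 0" if "0 < \<delta>" for \<delta>
    proof -
      have "hausdorff_pre_measure s \<delta> {p} \<le> (\<Sum>i::nat. diam_powr s {p})"
        unfolding hausdorff_pre_measure_def
        by (rule INF_lower) (use that in auto)
      also have "\<dots> = 0" using \<open>0 < s\<close> by (simp add: diam_powr_def)
      finally show ?thesis .
    qed
    then show ?thesis
      unfolding hausdorff_measure_def by (intro antisym SUP_least) auto
  qed
  have "hausdorff_dim {p} \<le> ennreal e" if "0 < e" for e
    unfolding hausdorff_dim_def by (rule INF_lower) (use meas that in auto)
  then show ?thesis
    by (metis ennreal_le_epsilon add_0 le_zero_eq)
qed

section \<open>Parameters returning to an annulus\<close>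

lemma mult_product_op_funpow:
  assumes "bounded_linear T"
  shows "(mult_product_op T l ^^ k) u = (\<chi> i. (l $ i) ^ k *\<^sub>R (T ^^ k) (u $ i))"
proof (induction k)
  case (Suc k)
  interpret bounded_linear T by fact
  have "(mult_product_op T l ^^ Suc k) u = mult_product_op T l ((mult_product_op T l ^^ k) u)"
    by simp
  also have "\<dots> = (\<chi> i. (l $ i) ^ Suc k *\<^sub>R (T ^^ Suc k) (u $ i))"
    unfolding Suc by (simp add: mult_product_op_def scaleR)
  finally show ?case .
qed simp

text \<open>
  The powers have ratio \<open>(x / y)\<^sup>k < 2\<close>, while Bernoulli's inequality bounds this ratio below by
  \<open>1 + k (x - y) / y\<close>.
\<close>

lemma diff_le_if_powers_comparable:
  fixes x y :: real
  assumes "0 < y" "y \<le> x" "0 < k" "0 \<le> n" "1 < y ^ k * n" "x ^ k * n < 2"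
  shows "x - y \<le> y / real k"
proof -
  define z where "z = (x - y) / y"
  have z: "0 \<le> z" "x = y * (1 + z)" using assms by (auto simp: z_def field_simps)
  have "1 + real k * z \<le> (1 + z) ^ k"
    using z by (intro Bernoulli_inequality) auto
  also have "\<dots> \<le> (1 + z) ^ k * (y ^ k * n)"
    using z assms by simp
  also have "\<dots> = x ^ k * n" by (simp add: z power_mult_distrib)
  also have "\<dots> < 2" by fact
  finally have "real k * z < 1" by simp
  then show ?thesis using assms by (simp add: z_def field_simps)
qed

lemma return_set_diameter:
  fixes T :: "'a::real_normed_vector \<Rightarrow> 'a" and x y :: "real ^ 'd"
  assumes T: "bounded_linear T" and "0 < k"
    and x: "\<And>i. 0 < x $ i" "\<And>i. x $ i \<le> M" and y: "\<And>i. 0 < y $ i" "\<And>i. y $ i \<le> M"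
    and xU: "\<And>i. norm ((mult_product_op T x ^^ k) u $ i) \<in> {1<..<2}"
    and yU: "\<And>i. norm ((mult_product_op T y ^^ k) u $ i) \<in> {1<..<2}"
  shows "dist x y \<le> real CARD('d) * M / real k"
proof -
  have "\<bar>x $ i - y $ i\<bar> \<le> M / real k" for i
  proof -
    let ?n = "norm ((T ^^ k) (u $ i))"
    have bx: "1 < (x $ i) ^ k * ?n" "(x $ i) ^ k * ?n < 2" and yb: "1 < (y $ i) ^ k * ?n" "(y $ i) ^ k * ?n < 2"
      using xU[of i] yU[of i] x(1)[of i] y(1)[of i] by (simp_all add: mult_product_op_funpow[OF T])
    have "x $ i - y $ i \<le> M / real k" if "y $ i \<le> x $ i"
      using diff_le_if_powers_comparable[OF y(1) that \<open>0 < k\<close> norm_ge_zero yb(1) bx(2)] y(2)[of i]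
        divide_right_mono[of "y $ i" M "real k"] by linarith
    moreover have "y $ i - x $ i \<le> M / real k" if "x $ i \<le> y $ i"
      using diff_le_if_powers_comparable[OF x(1) that \<open>0 < k\<close> norm_ge_zero bx(1) yb(2)] x(2)[of i]
        divide_right_mono[of "x $ i" M "real k"] by linarith
    ultimately show ?thesis by linarith
  qed
  then have "(\<Sum>i\<in>UNIV. \<bar>(x - y) $ i\<bar>) \<le> (\<Sum>i\<in>(UNIV :: 'd set). M / real k)"
    by (intro sum_mono) simp
  then show ?thesis
    using norm_le_l1_cart[of "x - y"] by (simp add: dist_norm)
qed

theorem theorem3p16:
  fixes T :: "'a::banach \<Rightarrow> 'a"
    and \<Lambda> :: "(real ^ 'd::finite) set"
    and s :: real
  assumes "separable_space (euclidean :: 'a topology)"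
    and "\<not> (\<exists>B :: 'a set. finite B \<and> span B = UNIV)"
    and "bounded_linear T"
    and "\<Lambda> \<subseteq> {l. \<forall>i. 0 < l $ i}"
    and "self_similar_fractal_OSC \<Lambda>"
    and "hausdorff_dim \<Lambda> = ennreal s"
    and "0 < s"
  shows "\<not> (\<exists>u :: 'a ^ 'd. common_upper_freq_hypercyclic \<Lambda> (mult_product_op T) u)"
proof
  assume "\<exists>u :: 'a ^ 'd. common_upper_freq_hypercyclic \<Lambda> (mult_product_op T) u"
  then obtain u :: "'a ^ 'd" where
    u: "\<And>l. l \<in> \<Lambda> \<Longrightarrow> upper_freq_hypercyclic (mult_product_op T l) u"
    by (auto simp: common_upper_freq_hypercyclic_def)
  obtain \<S> where ifs: "iterated_function_system \<S>" and inv: "invariant_set \<S> \<Lambda>"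
    using assms(5) by (auto simp: self_similar_fractal_OSC_def)
  have cpt: "compact \<Lambda>" and ne: "\<Lambda> \<noteq> {}" using inv by (auto simp: invariant_set_def)
  have pos: "0 < l $ i" if "l \<in> \<Lambda>" for l i using assms(4) that by auto
  define U :: "('a ^ 'd) set" where "U = (\<Inter>i. {v. 1 < norm (v $ i)} \<inter> {v. norm (v $ i) < 2})"
  have "open U"
    unfolding U_def
    by (intro open_INT open_Int open_Collect_less ballI continuous_intros) auto
  have "U \<noteq> {}"
  proof -
    have "span {} \<noteq> (UNIV :: 'a set)" using assms(2) by blast
    then obtain e :: 'a where "e \<noteq> 0" by auto
    then have "(\<chi> i. (3 / 2 / norm e) *\<^sub>R e) \<in> U" by (simp add: U_def)
    then show ?thesis by blast
  qed
  define V where "V k = {l\<in>\<Lambda>. (mult_product_op T l ^^ k) u \<in> U}" for k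
  obtain p where p: "p \<in> \<Lambda>" using ne by blast
  obtain q where q: "q \<in> \<Lambda>" "p \<noteq> q"
  proof (rule ccontr)
    assume "\<not> thesis"
    then have "\<Lambda> = {p}" using p that by blast
    then show False using hausdorff_dim_singleton[of p] assms(6,7) ennreal_eq_0_iff[of s] by simp
  qed
  obtain F \<rho> \<delta> where F: "\<And>b. F b ` \<Lambda> \<subseteq> \<Lambda>" "\<And>b. continuous_on UNIV (F b)"
    "\<And>b x y. \<rho> * dist x y \<le> dist (F b x) (F b y)"
    "\<And>x y. x \<in> \<Lambda> \<Longrightarrow> y \<in> \<Lambda> \<Longrightarrow> \<delta> \<le> dist (F True x) (F False y)"
    "0 < \<rho>" "\<rho> < 1" "0 < \<delta>"
    using self_similar_two_separated_copies[OF ifs inv p q] by blast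
  obtain M where "0 < M" and M: "\<And>l. l \<in> \<Lambda> \<Longrightarrow> norm l \<le> M"
    using compact_imp_bounded[OF cpt] by (auto simp: bounded_pos)
  have coord: "l $ i \<le> M" if "l \<in> \<Lambda>" for l i
    using component_le_norm_cart[of l i] M[OF that] by linarith
  \<comment> \<open>The factor \<open>2\<close> absorbs the shift from \<open>1 / k\<close> to \<open>1 / (k + 1)\<close> for \<open>k \<ge> 1\<close>, and
    \<open>C \<ge> 2 * M\<close> bounds the diameter of \<open>\<Lambda>\<close> itself, which takes care of \<open>k = 0\<close>.\<close>
  define C where "C = 2 * real CARD('d) * M"
  have C: "0 < C" "2 * M \<le> C" using \<open>0 < M\<close> by (auto simp: C_def Suc_le_eq)
  have V: "dist x y \<le> C / (real k + 1)" if xy: "x \<in> V k" "y \<in> V k" for k x y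
  proof (cases "k = 0")
    case True
    have "dist x y \<le> norm x + norm y" by (simp add: dist_norm norm_triangle_ineq4)
    also have "\<dots> \<le> 2 * M" using M[of x] M[of y] xy by (simp add: V_def)
    finally show ?thesis using C True by simp
  next
    case False
    have "dist x y \<le> real CARD('d) * M / real k"
      by (rule return_set_diameter[OF assms(3), where u = u])
        (use xy pos coord False in \<open>auto simp: V_def U_def\<close>)
    also have "\<dots> = C / (2 * real k)" by (simp add: C_def)
    also have "\<dots> \<le> C / (real k + 1)"
      using C False by (intro divide_left_mono) auto
    finally show ?thesis .
  qed
  obtain l where l: "l \<in> \<Lambda>" "upper_density {k. l \<in> V k} = 0"
    using ex_point_visits_have_density_0[OF F cpt ne C(1) V] by blast
  have "0 < upper_density {k. (mult_product_op T l ^^ k) u \<in> U}"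
    using u[OF l(1)] \<open>open U\<close> \<open>U \<noteq> {}\<close> by (auto simp: upper_freq_hypercyclic_def)
  with l show False by (simp add: V_def)
qed

end
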